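(* For every real number $\beta\in(1,2)$, Garsia's entropy satisfies $H_\beta>0.82$.
   Context: For real $\beta\in(1,2)$ put $I_\beta=[0,1/(\beta-1)]$. For $n\ge 1$ let $$D_n(\beta)=\Bigl\{x\in I_\beta : x=\sum_{k=1}^n a_k\beta^{-k}\ \text{with } a_k\in\{0,1\}\Bigr\},$$ and for $x\in D_n(\beta)$ let $$p_n(x)=\#\Bigl\{(a_1,\dots,a_n)\in\{0,1\}^n : x=\sum_{k=1}^n a_k\beta^{-k}\Bigr\}.$$ Put $$H_n(\beta)=-\sum_{x\in D_n(\beta)}\frac{p_n(x)}{2^n}\log\frac{p_n(x)}{2^n},$$ with $\log$ the natural logarithm. Garsia's entropy is $$H_\beta=\lim_{n\to\infty}\frac{H_n(\beta)}{n\log\beta},$$ where the limit exists because $n\mapsto H_n(\beta)$ is subadditive. *)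

theory Defs
  imports Complex_Main "HOL-Library.FuncSet"
begin

(* The words (a_1, ..., a_n) in {0,1}^n, as extensional functions on {1..n}, so that
   there are exactly 2^n of them and card below counts words. *)
definition words :: "nat \<Rightarrow> (nat \<Rightarrow> nat) set" where
  "words n = {1..n} \<rightarrow>\<^sub>E {0, 1}"

definition beta_value :: "real \<Rightarrow> nat \<Rightarrow> (nat \<Rightarrow> nat) \<Rightarrow> real" where
  "beta_value \<beta> n a = (\<Sum>k=1..n. real (a k) / \<beta> ^ k)"

definition I_beta :: "real \<Rightarrow> real set" where
  "I_beta \<beta> = {0 .. 1 / (\<beta> - 1)}"

definition D_set :: "real \<Rightarrow> nat \<Rightarrow> real set" where
  "D_set \<beta> n = {x \<in> I_beta \<beta>. \<exists>a \<in> words n. x = beta_value \<beta> n a}"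

definition p_count :: "real \<Rightarrow> nat \<Rightarrow> real \<Rightarrow> nat" where
  "p_count \<beta> n x = card {a \<in> words n. x = beta_value \<beta> n a}"

definition H_ent :: "real \<Rightarrow> nat \<Rightarrow> real" where
  "H_ent \<beta> n = - (\<Sum>x \<in> D_set \<beta> n. (real (p_count \<beta> n x) / 2 ^ n) * ln (real (p_count \<beta> n x) / 2 ^ n))"

(* The limit exists for 1 < \<beta> < 2, since H_ent \<beta> is subadditive in n and nonnegative. *)
definition garsia_entropy :: "real \<Rightarrow> real" where
  "garsia_entropy \<beta> = lim (\<lambda>n. H_ent \<beta> n / (real n * ln \<beta>))"

end

theory Submission
  imports Defs
begin

text \<open>
  Writing the entropy as an average over words gives \<open>H_n = n log 2 - 2^(-n) \<Sum>_a log p_n(x_a)\<close>,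
  where \<open>x_a\<close> is the value of the word \<open>a\<close>. By concavity of the logarithm the average is at most
  the logarithm of the average of \<open>p_n(x_a)\<close>, and the sum of the \<open>p_n(x_a)\<close> is the number \<open>N_n\<close>
  of collisions, that is of pairs of words with the same value. Hence \<open>H_n \<ge> log (4^n / N_n)\<close>
  (lemma \<open>H_ent_ge_collisions\<close>), and it suffices to bound the exponential growth of \<open>N_n\<close>.

  A collision is a path of the random walk \<open>x \<mapsto> \<beta> x + \<epsilon>\<close> that starts and ends at 0, where the
  steps \<open>\<epsilon> = -1, 0, 1\<close> are differences of binary digits and so have multiplicities 1, 2, 1. If a
  nonnegative function \<open>\<psi>\<close> with maximum at 0 satisfies
  \<open>\<psi>(\<beta> x + 1) + 2 \<psi>(\<beta> x) + \<psi>(\<beta> x - 1) \<le> \<rho> \<psi>(x)\<close> for all \<open>x\<close>, then \<open>N_n \<le> \<rho>^n\<close>, and Garsia's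
  entropy is at least \<open>log (4 / \<rho>) / log \<beta>\<close>.

  The bound for \<open>\<beta>\<close> follows already from a potential \<open>\<psi>\<close> for some power \<open>\<gamma> = \<beta>^k\<close>: fix all
  digits whose position is not a multiple of \<open>k\<close>, which costs a factor of at most 4 each, and
  run the walk for \<open>\<gamma>\<close> on the remaining ones (lemma \<open>garsia_entropy_ge_potential\<close>). Every \<open>\<beta>\<close> in
  the open interval from 1 to 2 has a power between 1.52 and \<open>1.52^2 = 2.3104\<close>, so potentials
  are needed for such \<open>\<gamma>\<close> only, with \<open>\<rho> < 4 / \<gamma>^0.82\<close>. For \<open>\<gamma> \<ge> 2\<close> the hat function has \<open>\<rho> = 2\<close>,
  which is small enough because 2.3104 is less than \<open>2^(1 / 0.82)\<close>. For \<open>\<gamma>\<close> between 1.52 and 2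
  there are step functions with 50 steps; as the required \<open>\<rho>\<close> leaves a margin over the true
  growth rate, one step function serves a whole interval of \<open>\<gamma>\<close>, and six of them suffice. Their
  inequalities are finitely many comparisons of integers.

  Since Garsia's entropy is a limit, its existence is part of the proof; it follows from the
  subadditivity of \<open>H_n\<close> (lemma \<open>H_ent_subadditive\<close>) by Fekete's argument.
\<close>

section \<open>Subadditive sequences\<close>

lemma subadditive_mult_le:
  fixes f :: "nat \<Rightarrow> real"
  assumes sub: "\<And>m n. f (m + n) \<le> f m + f n"
  shows "f (q * m + r) \<le> real q * f m + f r"
proof (induction q)
  case (Suc q)
  have "f (Suc q * m + r) = f (m + (q * m + r))" by (simp add: algebra_simps)
  also have "\<dots> \<le> f m + f (q * m + r)" by (rule sub)
  also have "\<dots> \<le> real (Suc q) * f m + f r" using Suc by (simp add: algebra_simps)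
  finally show ?case .
qed simp

text \<open>
  Fekete's lemma for nonnegative sequences: division of \<open>n\<close> by a fixed \<open>m\<close> with remainder shows
  that \<open>f n / n\<close> exceeds \<open>f m / m\<close> by a term of order \<open>1 / n\<close> only, so the limit is the infimum.
\<close>

lemma subadditive_convergent:
  fixes f :: "nat \<Rightarrow> real"
  assumes sub: "\<And>m n. f (m + n) \<le> f m + f n" and nonneg: "\<And>n. 0 \<le> f n"
  shows "convergent (\<lambda>n. f n / real n)"
proof -
  define L where "L = (INF n\<in>{1..}. f n / real n)"
  have bdd: "bdd_below ((\<lambda>n. f n / real n) ` {1..})"
    by (rule bdd_belowI[of _ 0]) (auto simp: nonneg)
  have lower: "L \<le> f n / real n" if "n \<ge> 1" for n
    unfolding L_def by (rule cINF_lower[OF bdd]) (use that in auto)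
  have "(\<lambda>n. f n / real n) \<longlonglongrightarrow> L"
  proof (rule order_tendstoI)
    fix a assume a: "a < L"
    show "\<forall>\<^sub>F n in sequentially. a < f n / real n"
      using eventually_ge_at_top[of 1] by eventually_elim (use a lower in force)
  next
    fix a assume "L < a"
    then obtain m where m: "m \<ge> 1" "f m / real m < a"
      unfolding L_def using cINF_less_iff[OF _ bdd, of a] by auto
    define B where "B = Max (f ` {..<m})"
    have B: "f r \<le> B" if "r < m" for r unfolding B_def using that by auto
    have B0: "0 \<le> B" using B[of 0] nonneg[of 0] m by simp
    have upper: "f n / real n \<le> f m / real m + B / real n" if n: "n \<ge> 1" for n
    proof -
      have "f n = f (n div m * m + n mod m)" by simp
      also have "\<dots> \<le> real (n div m) * f m + f (n mod m)" using sub by (rule subadditive_mult_le)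
      also have "\<dots> \<le> (real n / real m) * f m + B"
        using B[of "n mod m"] m nonneg[of m]
        by (intro add_mono mult_right_mono of_nat_div_le_of_nat) auto
      finally show ?thesis using n m by (simp add: field_simps)
    qed
    have "(\<lambda>n. f m / real m + B / real n) \<longlonglongrightarrow> f m / real m + 0"
      by (intro tendsto_add tendsto_const lim_const_over_n)
    then have "\<forall>\<^sub>F n in sequentially. f m / real m + B / real n < a"
      using m(2) by (auto dest!: order_tendstoD(2))
    then show "\<forall>\<^sub>F n in sequentially. f n / real n < a"
      using eventually_ge_at_top[of 1] by eventually_elim (use upper in force)
  qed
  then show ?thesis by (auto simp: convergent_def)
qed

section \<open>The entropy as an average over words\<close>

lemma finite_words [simp]: "finite (words n)"
  by (simp add: words_def finite_PiE)

lemma card_words: "card (words n) = 2 ^ n"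
  by (simp add: words_def card_PiE numeral_2_eq_2)

lemma sum_inverse_powers_le:
  fixes \<beta> :: real
  assumes "1 < \<beta>"
  shows "(\<Sum>k=1..n. 1 / \<beta> ^ k) \<le> 1 / (\<beta> - 1)"
proof -
  have "(\<Sum>k=1..n. 1 / \<beta> ^ k) = (1 - 1 / \<beta> ^ n) / (\<beta> - 1)"
  proof (induction n)
    case (Suc n)
    have "(\<Sum>k=1..Suc n. 1 / \<beta> ^ k) = (1 - 1 / \<beta> ^ n) / (\<beta> - 1) + 1 / \<beta> ^ Suc n"
      using Suc by simp
    also have "\<dots> = (1 - 1 / \<beta> ^ Suc n) / (\<beta> - 1)"
      using assms by (simp add: field_simps)
    finally show ?case .
  qed simp
  also have "\<dots> \<le> 1 / (\<beta> - 1)" using assms by (intro divide_right_mono) auto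
  finally show ?thesis .
qed

text \<open>
  Every value of a word lies in \<open>I_beta\<close>, so that condition does not remove any point from
  \<open>D_set\<close>.
\<close>

lemma D_set_eq_image:
  assumes "1 < \<beta>"
  shows "D_set \<beta> n = beta_value \<beta> n ` words n"
proof -
  have "beta_value \<beta> n a \<in> I_beta \<beta>" if a: "a \<in> words n" for a
  proof -
    have le1: "real (a k) \<le> 1" if "k \<in> {1..n}" for k
      using a that by (auto simp: words_def PiE_def Pi_def)
    have "beta_value \<beta> n a \<le> (\<Sum>k=1..n. 1 / \<beta> ^ k)"
      unfolding beta_value_def using assms le1 by (intro sum_mono divide_right_mono) auto
    moreover have "0 \<le> beta_value \<beta> n a"
      unfolding beta_value_def using assms by (intro sum_nonneg) auto
    ultimately show ?thesis
      using sum_inverse_powers_le[OF assms, of n] by (simp add: I_beta_def)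
  qed
  then show ?thesis by (auto simp: D_set_def)
qed

lemma p_count_pos: "a \<in> words n \<Longrightarrow> 0 < p_count \<beta> n (beta_value \<beta> n a)"
  unfolding p_count_def by (subst card_gt_0_iff) auto

lemma p_count_le: "p_count \<beta> n x \<le> 2 ^ n"
  unfolding p_count_def card_words[symmetric] by (intro card_mono) auto

text \<open>
  A value \<open>x\<close> occurs for exactly \<open>p_count \<beta> n x\<close> words; summing over the words therefore
  supplies the weights. In this form subadditivity and the collision bound become termwise
  inequalities.
\<close>

lemma H_ent_eq_average:
  assumes "1 < \<beta>"
  shows "H_ent \<beta> n = real n * ln 2 - (\<Sum>a\<in>words n. ln (p_count \<beta> n (beta_value \<beta> n a))) / 2 ^ n"
proof -
  let ?S = "beta_value \<beta> n" and ?p = "\<lambda>x. real (p_count \<beta> n x)"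
  have "(\<Sum>x\<in>D_set \<beta> n. ?p x / 2 ^ n * ln (?p x / 2 ^ n)) =
        (\<Sum>x\<in>?S ` words n. \<Sum>a\<in>{a \<in> words n. ?S a = x}. ln (?p (?S a) / 2 ^ n) / 2 ^ n)"
  proof (intro sum.cong)
    fix x
    have fibre: "real (card {a \<in> words n. ?S a = x}) = ?p x"
      by (simp add: p_count_def eq_commute[of x])
    have "(\<Sum>a\<in>{a \<in> words n. ?S a = x}. ln (?p (?S a) / 2 ^ n) / 2 ^ n)
        = (\<Sum>a\<in>{a \<in> words n. ?S a = x}. ln (?p x / 2 ^ n) / 2 ^ n)"
      by (intro sum.cong) auto
    also have "\<dots> = ?p x / 2 ^ n * ln (?p x / 2 ^ n)"
      by (simp only: sum_constant fibre) simp
    finally show "?p x / 2 ^ n * ln (?p x / 2 ^ n) =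
        (\<Sum>a\<in>{a \<in> words n. ?S a = x}. ln (?p (?S a) / 2 ^ n) / 2 ^ n)" by (rule sym)
  qed (simp add: D_set_eq_image[OF assms])
  also have "\<dots> = (\<Sum>a\<in>words n. ln (?p (?S a) / 2 ^ n) / 2 ^ n)"
    by (rule sum.group) auto
  also have "\<dots> = (\<Sum>a\<in>words n. (ln (?p (?S a)) - real n * ln 2) / 2 ^ n)"
    by (intro sum.cong) (auto simp: ln_div ln_realpow p_count_pos)
  also have "\<dots> = (\<Sum>a\<in>words n. ln (?p (?S a))) / 2 ^ n - real n * ln 2"
    by (simp add: sum_subtractf card_words diff_divide_distrib sum_divide_distrib)
  finally show ?thesis by (simp add: H_ent_def)
qed

lemma H_ent_nonneg:
  assumes "1 < \<beta>"
  shows "0 \<le> H_ent \<beta> n"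
proof -
  have "(\<Sum>a\<in>words n. ln (p_count \<beta> n (beta_value \<beta> n a))) \<le> (\<Sum>a\<in>words n. real n * ln 2)"
  proof (intro sum_mono)
    fix a assume a: "a \<in> words n"
    have "real (p_count \<beta> n (beta_value \<beta> n a)) \<le> 2 ^ n"
      using p_count_le[of \<beta> n] by (metis of_nat_le_iff of_nat_numeral of_nat_power)
    then have "ln (real (p_count \<beta> n (beta_value \<beta> n a))) \<le> ln (2 ^ n)"
      using p_count_pos[OF a, of \<beta>] by (intro ln_mono) auto
    then show "ln (real (p_count \<beta> n (beta_value \<beta> n a))) \<le> real n * ln 2"
      by (simp add: ln_realpow)
  qed
  then show ?thesis
    unfolding H_ent_eq_average[OF assms] by (simp add: card_words field_simps)
qed

definition append_word :: "nat \<Rightarrow> nat \<Rightarrow> (nat \<Rightarrow> nat) \<Rightarrow> (nat \<Rightarrow> nat) \<Rightarrow> nat \<Rightarrow> nat" where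
  "append_word m n a b = (\<lambda>i\<in>{1..m + n}. if i \<le> m then a i else b (i - m))"

lemma append_word_in_words:
  assumes "a \<in> words m" "b \<in> words n"
  shows "append_word m n a b \<in> words (m + n)"
proof -
  have "i - m \<in> {1..n}" if "i \<in> {1..m+n}" "\<not> i \<le> m" for i using that by auto
  then show ?thesis using assms
    unfolding append_word_def words_def PiE_def Pi_def by (auto simp: Suc_le_eq)
qed

lemma bij_betw_append_word:
  "bij_betw (\<lambda>(a, b). append_word m n a b) (words m \<times> words n) (words (m + n))"
proof (rule bij_betw_byWitness[where
      f' = "\<lambda>w. (restrict w {1..m}, \<lambda>i\<in>{1..n}. w (m + i))"])
  show "\<forall>p\<in>words m \<times> words n. (\<lambda>w. (restrict w {1..m}, \<lambda>i\<in>{1..n}. w (m + i))) ((\<lambda>(a, b). append_word m n a b) p) = p"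
    by (auto simp: append_word_def words_def PiE_def extensional_def fun_eq_iff)
  show "\<forall>w\<in>words (m + n). (\<lambda>(a, b). append_word m n a b) ((\<lambda>w. (restrict w {1..m}, \<lambda>i\<in>{1..n}. w (m + i))) w) = w"
    by (auto simp: append_word_def words_def PiE_def extensional_def fun_eq_iff)
  show "(\<lambda>(a, b). append_word m n a b) ` (words m \<times> words n) \<subseteq> words (m + n)"
    by (auto simp: append_word_in_words)
  show "(\<lambda>w. (restrict w {1..m}, \<lambda>i\<in>{1..n}. w (m + i))) ` words (m + n) \<subseteq> words m \<times> words n"
    by (fastforce simp: words_def PiE_def Pi_def)
qed

lemma beta_value_append_word:
  "beta_value \<beta> (m + n) (append_word m n a b) = beta_value \<beta> m a + beta_value \<beta> n b / \<beta> ^ m"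
proof -
  let ?f = "\<lambda>k. real (append_word m n a b k) / \<beta> ^ k"
  have "{1..m + n} = {1..m} \<union> {m + 1..m + n}" by auto
  then have "beta_value \<beta> (m + n) (append_word m n a b) = sum ?f {1..m} + sum ?f {m + 1..m + n}"
    unfolding beta_value_def by (simp only:) (subst sum.union_disjoint; auto)
  also have "sum ?f {1..m} = beta_value \<beta> m a"
    unfolding beta_value_def by (intro sum.cong) (auto simp: append_word_def)
  also have "sum ?f {m + 1..m + n} = (\<Sum>k=1..n. ?f (k + m))"
    using sum.shift_bounds_cl_nat_ivl[of ?f 1 m n] by (simp add: add.commute)
  also have "\<dots> = (\<Sum>k=1..n. real (b k) / \<beta> ^ k / \<beta> ^ m)"
    by (intro sum.cong) (auto simp: append_word_def power_add)
  also have "\<dots> = beta_value \<beta> n b / \<beta> ^ m"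
    by (simp add: beta_value_def sum_divide_distrib)
  finally show ?thesis .
qed

text \<open>
  Concatenating a representation of \<open>x\<close> with one of \<open>y\<close> represents \<open>x + y / \<beta> ^ m\<close>, and distinct
  pairs give distinct words. There may be further representations, hence only an inequality.
\<close>

lemma p_count_append_word_ge:
  "p_count \<beta> m x * p_count \<beta> n y \<le> p_count \<beta> (m + n) (x + y / \<beta> ^ m)"
proof -
  let ?A = "{a \<in> words m. x = beta_value \<beta> m a}" and ?B = "{b \<in> words n. y = beta_value \<beta> n b}"
  have "card (?A \<times> ?B) \<le> card {w \<in> words (m + n). x + y / \<beta> ^ m = beta_value \<beta> (m + n) w}"
  proof (rule card_inj_on_le)
    show "inj_on (\<lambda>(a, b). append_word m n a b) (?A \<times> ?B)"
      by (rule inj_on_subset[OF bij_betw_imp_inj_on[OF bij_betw_append_word]]) auto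
  qed (auto simp: append_word_in_words beta_value_append_word)
  then show ?thesis by (simp add: p_count_def card_cartesian_product)
qed

lemma H_ent_subadditive:
  assumes "1 < \<beta>"
  shows "H_ent \<beta> (m + n) \<le> H_ent \<beta> m + H_ent \<beta> n"
proof -
  let ?l = "\<lambda>n a. ln (real (p_count \<beta> n (beta_value \<beta> n a)))"
  have "(\<Sum>a\<in>words m. \<Sum>b\<in>words n. ?l m a + ?l n b)
      \<le> (\<Sum>a\<in>words m. \<Sum>b\<in>words n. ?l (m + n) (append_word m n a b))"
  proof (intro sum_mono)
    fix a b assume ab: "a \<in> words m" "b \<in> words n"
    have pos: "0 < p_count \<beta> m (beta_value \<beta> m a)" "0 < p_count \<beta> n (beta_value \<beta> n b)"
      using ab p_count_pos by auto
    have "?l m a + ?l n b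
        = ln (real (p_count \<beta> m (beta_value \<beta> m a) * p_count \<beta> n (beta_value \<beta> n b)))"
      using pos by (simp add: ln_mult)
    also have "\<dots> \<le> ?l (m + n) (append_word m n a b)"
      unfolding beta_value_append_word
      using p_count_append_word_ge[of \<beta> m "beta_value \<beta> m a" n "beta_value \<beta> n b"] pos
      by (intro ln_mono) (auto simp flip: of_nat_mult)
    finally show "?l m a + ?l n b \<le> ?l (m + n) (append_word m n a b)" .
  qed
  also have "\<dots> = (\<Sum>w\<in>words (m + n). ?l (m + n) w)"
    using sum.reindex_bij_betw[OF bij_betw_append_word, of "?l (m + n)" m n]
    by (simp add: sum.cartesian_product case_prod_unfold)
  finally have "2 ^ n * sum (?l m) (words m) + 2 ^ m * sum (?l n) (words n) \<le> sum (?l (m + n)) (words (m + n))"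
    by (simp add: sum.distrib card_words sum_distrib_left)
  then have "(2 ^ n * sum (?l m) (words m) + 2 ^ m * sum (?l n) (words n)) / 2 ^ (m + n)
      \<le> sum (?l (m + n)) (words (m + n)) / 2 ^ (m + n)"
    by (rule divide_right_mono) simp
  then have "sum (?l m) (words m) / 2 ^ m + sum (?l n) (words n) / 2 ^ n
      \<le> sum (?l (m + n)) (words (m + n)) / 2 ^ (m + n)"
    by (simp add: add_divide_distrib power_add)
  then show ?thesis
    by (simp add: H_ent_eq_average[OF assms] algebra_simps)
qed

section \<open>Counting collisions\<close>

text \<open>
  Collisions proper are the case \<open>x = 0\<close>. The offset \<open>x\<close> makes the count computable digit by
  digit, and arbitrary index sets \<open>I\<close> allow the digits to be removed in any order.
\<close>

definition collisions :: "nat set \<Rightarrow> (nat \<Rightarrow> real) \<Rightarrow> real \<Rightarrow> real" where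
  "collisions I c x = (\<Sum>a \<in> I \<rightarrow>\<^sub>E {0, 1}. \<Sum>b \<in> I \<rightarrow>\<^sub>E {0, 1}.
     of_bool (x + (\<Sum>i\<in>I. (real (a i) - real (b i)) * c i) = 0))"

lemma sum_binary_words_insert:
  fixes g :: "(nat \<Rightarrow> nat) \<Rightarrow> 'a :: comm_monoid_add"
  assumes "i \<notin> I"
  shows "(\<Sum>a \<in> insert i I \<rightarrow>\<^sub>E {0, 1}. g a) = (\<Sum>a \<in> I \<rightarrow>\<^sub>E {0, 1}. g (a(i := 0)) + g (a(i := 1)))"
proof -
  have "(\<Sum>a \<in> insert i I \<rightarrow>\<^sub>E {0, 1}. g a)
      = (\<Sum>(d, a) \<in> {0, 1} \<times> (I \<rightarrow>\<^sub>E {0, 1}). g (a(i := d)))"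
    unfolding PiE_insert_eq
    by (subst sum.reindex[OF inj_combinator[OF assms]]) (simp add: case_prod_unfold)
  also have "\<dots> = (\<Sum>d \<in> {0, 1}. \<Sum>a \<in> I \<rightarrow>\<^sub>E {0, 1}. g (a(i := d)))"
    by (simp add: sum.cartesian_product)
  finally show ?thesis by (simp add: sum.distrib)
qed

text \<open>
  The difference of two binary digits is 0 in two ways, and 1 and -1 in one way each.
\<close>

lemma collisions_insert:
  assumes "finite I" "i \<notin> I"
  shows "collisions (insert i I) c x
    = collisions I c (x + c i) + 2 * collisions I c x + collisions I c (x - c i)"
proof -
  let ?W = "I \<rightarrow>\<^sub>E {0, 1 :: nat}"
  let ?d = "\<lambda>a b. \<Sum>j\<in>I. (real (a j) - real (b j)) * c j"
  have upd: "(\<Sum>j\<in>insert i I. (real ((a(i := u)) j) - real ((b(i := v)) j)) * c j)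
      = (real u - real v) * c i + ?d a b" for a b u v
    using assms by (simp, intro sum.cong) auto
  have "collisions (insert i I) c x = (\<Sum>a\<in>?W. \<Sum>b\<in>?W.
      of_bool (x + c i + ?d a b = 0) + 2 * of_bool (x + ?d a b = 0) + of_bool (x - c i + ?d a b = 0))"
    unfolding collisions_def sum_binary_words_insert[OF assms(2)] upd
    by (simp add: sum.distrib[symmetric] algebra_simps)
  then show ?thesis
    by (simp add: collisions_def sum.distrib sum_distrib_left)
qed

text \<open>
  Each of the \<open>4 ^ card K\<close> choices of digits on \<open>K\<close> just moves the offset for \<open>J\<close>, so a bound
  for \<open>J\<close> that is uniform in the offset is all that is needed.
\<close>

lemma collisions_union_le:
  assumes "finite K" "finite J" "K \<inter> J = {}" and "\<And>x. collisions J c x \<le> B"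
  shows "collisions (K \<union> J) c x \<le> 4 ^ card K * B"
  using assms(1,3)
proof (induction K arbitrary: x)
  case empty
  then show ?case using assms by simp
next
  case (insert k K)
  have "collisions (insert k K \<union> J) c x = collisions (K \<union> J) c (x + c k)
      + 2 * collisions (K \<union> J) c x + collisions (K \<union> J) c (x - c k)"
    using insert assms(2) by (simp add: collisions_insert)
  also have "\<dots> \<le> 4 * (4 ^ card K * B)"
    using insert.IH[of "x + c k"] insert.IH[of x] insert.IH[of "x - c k"] insert.prems by auto
  finally show ?case using insert by simp
qed

lemma sum_p_count_eq_collisions:
  "(\<Sum>a\<in>words n. real (p_count \<beta> n (beta_value \<beta> n a))) = collisions {1..n} (\<lambda>i. 1 / \<beta> ^ i) 0"
proof -
  have "real (p_count \<beta> n (beta_value \<beta> n a)) = (\<Sum>b\<in>words n. of_bool (beta_value \<beta> n a = beta_value \<beta> n b))" for a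
    by (simp add: p_count_def of_bool_def sum.If_cases Int_def)
  moreover have "beta_value \<beta> n a = beta_value \<beta> n b \<longleftrightarrow>
      0 + (\<Sum>i=1..n. (real (a i) - real (b i)) * (1 / \<beta> ^ i)) = 0" for a b
    by (simp add: beta_value_def diff_divide_distrib sum_subtractf)
  ultimately show ?thesis by (simp add: collisions_def words_def)
qed

text \<open>
  Jensen's inequality for the logarithm, obtained by comparing each \<open>ln p\<close> with the tangent of
  \<open>ln\<close> at the mean \<open>m\<close> of the numbers \<open>p\<close>.
\<close>

lemma H_ent_ge_collisions:
  assumes "1 < \<beta>" and le: "collisions {1..n} (\<lambda>i. 1 / \<beta> ^ i) 0 \<le> C"
  shows "real n * ln 4 - ln C \<le> H_ent \<beta> n"
proof -
  let ?p = "\<lambda>a. real (p_count \<beta> n (beta_value \<beta> n a))"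
  define m where "m = (\<Sum>a\<in>words n. ?p a) / 2 ^ n"
  have ne: "words n \<noteq> {}" using card_words[of n] by auto
  have sum_pos: "0 < (\<Sum>a\<in>words n. ?p a)" by (intro sum_pos ne) (auto simp: p_count_pos)
  then have m: "0 < m" by (simp add: m_def)
  have "(\<Sum>a\<in>words n. ln (?p a)) \<le> (\<Sum>a\<in>words n. ?p a / m - 1 + ln m)"
  proof (intro sum_mono)
    fix a assume "a \<in> words n"
    then have p: "0 < ?p a" by (simp add: p_count_pos)
    then have "ln (?p a / m) \<le> ?p a / m - 1" using m by (intro ln_le_minus_one) auto
    then show "ln (?p a) \<le> ?p a / m - 1 + ln m" using p m by (simp add: ln_div)
  qed
  also have "\<dots> = (\<Sum>a\<in>words n. ?p a) / m + 2 ^ n * (ln m - 1)"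
    by (simp add: sum.distrib sum_subtractf card_words sum_divide_distrib algebra_simps)
  also have "\<dots> = 2 ^ n * ln m" using m sum_pos by (simp add: m_def field_simps)
  finally have "(\<Sum>a\<in>words n. ln (?p a)) / 2 ^ n \<le> ln m" by (simp add: field_simps)
  moreover have "ln m = ln (\<Sum>a\<in>words n. ?p a) - real n * ln 2"
    using sum_pos by (simp add: m_def ln_div ln_realpow)
  moreover have "ln (\<Sum>a\<in>words n. ?p a) \<le> ln C"
    using le sum_pos by (intro ln_mono) (auto simp: sum_p_count_eq_collisions)
  moreover have "ln (4 :: real) = 2 * ln 2" using ln_realpow[of 2 2] by simp
  ultimately show ?thesis unfolding H_ent_eq_average[OF assms(1)] by simp
qed

section \<open>Potentials\<close>

text \<open>
  A potential is a nonnegative superharmonic function, up to the factor \<open>\<rho>\<close>, for the walk whose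
  closed paths are the collisions. The requirement that it is maximal at 0 yields a bound for
  all offsets with constant 1.
\<close>

definition collision_potential :: "real \<Rightarrow> real \<Rightarrow> (real \<Rightarrow> real) \<Rightarrow> bool" where
  "collision_potential \<gamma> \<rho> \<psi> \<longleftrightarrow> 0 < \<rho> \<and> 0 < \<psi> 0 \<and> (\<forall>x. 0 \<le> \<psi> x \<and> \<psi> x \<le> \<psi> 0) \<and>
     (\<forall>x. \<psi> (\<gamma> * x + 1) + 2 * \<psi> (\<gamma> * x) + \<psi> (\<gamma> * x - 1) \<le> \<rho> * \<psi> x)"

text \<open>
  The last \<open>i\<close> positions among the multiples \<open>k, 2k, ..., nk\<close> have the weights \<open>1 / \<gamma> ^ j\<close> for
  \<open>n - i < j \<le> n\<close>, where \<open>\<gamma> = \<beta> ^ k\<close>. Multiplying the offset \<open>x\<close> by \<open>\<gamma> ^ (n - i)\<close> gives the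
  current position of the walk; adding the next position to the left is one application of the
  inequality for \<open>\<psi>\<close>.
\<close>

lemma collisions_le_potential:
  fixes \<beta> :: real
  assumes pot: "collision_potential (\<beta> ^ k) \<rho> \<psi>" and "\<beta> > 0" "k \<ge> 1" "i \<le> n"
  shows "collisions ((*) k ` {n - i<..n}) (\<lambda>j. 1 / \<beta> ^ j) x * \<psi> 0 \<le> \<rho> ^ i * \<psi> ((\<beta> ^ k) ^ (n - i) * x)"
  using assms(4)
proof (induction i arbitrary: x)
  case 0
  then show ?case using pot by (auto simp: collisions_def collision_potential_def)
next
  case (Suc i)
  define c where "c = (\<lambda>j. 1 / \<beta> ^ j)"
  define \<gamma> where "\<gamma> = \<beta> ^ k"
  define J where "J = (*) k ` {n - i<..n}"
  define y where "y = \<gamma> ^ (n - Suc i) * x"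
  have \<gamma>: "\<gamma> > 0" using assms by (simp add: \<gamma>_def)
  have c: "c (k * (n - i)) = 1 / \<gamma> ^ (n - i)" by (simp add: c_def \<gamma>_def power_mult)
  have step: "n - i = Suc (n - Suc i)" using Suc.prems by simp
  have "{n - Suc i<..n} = insert (n - i) {n - i<..n}" using Suc.prems by auto
  then have set: "(*) k ` {n - Suc i<..n} = insert (k * (n - i)) J" by (simp add: J_def)
  have notin: "k * (n - i) \<notin> J" using assms(3) by (auto simp: J_def)
  have IH: "collisions J c z * \<psi> 0 \<le> \<rho> ^ i * \<psi> (\<gamma> ^ (n - i) * z)" for z
    using Suc.IH[of z] Suc.prems by (simp add: J_def c_def \<gamma>_def)
  have shift: "\<gamma> ^ (n - i) * (x + 1 / \<gamma> ^ (n - i)) = \<gamma> * y + 1" "\<gamma> ^ (n - i) * (x - 1 / \<gamma> ^ (n - i)) = \<gamma> * y - 1"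
    "\<gamma> ^ (n - i) * x = \<gamma> * y"
    using \<gamma> unfolding y_def step by (simp_all add: field_simps)
  have "collisions (insert (k * (n - i)) J) c x * \<psi> 0
      = collisions J c (x + 1 / \<gamma> ^ (n - i)) * \<psi> 0 + 2 * (collisions J c x * \<psi> 0)
        + collisions J c (x - 1 / \<gamma> ^ (n - i)) * \<psi> 0"
    by (subst collisions_insert[OF _ notin]) (simp_all add: J_def c distrib_right)
  also have "\<dots> \<le> \<rho> ^ i * \<psi> (\<gamma> * y + 1) + 2 * (\<rho> ^ i * \<psi> (\<gamma> * y)) + \<rho> ^ i * \<psi> (\<gamma> * y - 1)"
    using IH[of "x + 1 / \<gamma> ^ (n - i)"] IH[of x] IH[of "x - 1 / \<gamma> ^ (n - i)"] unfolding shift by simp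
  also have "\<dots> = \<rho> ^ i * (\<psi> (\<gamma> * y + 1) + 2 * \<psi> (\<gamma> * y) + \<psi> (\<gamma> * y - 1))" by (simp add: algebra_simps)
  also have "\<dots> \<le> \<rho> ^ i * (\<rho> * \<psi> y)"
    using pot by (intro mult_left_mono) (auto simp: collision_potential_def \<gamma>_def)
  finally show ?case unfolding set by (simp add: y_def \<gamma>_def c_def algebra_simps)
qed

text \<open>
  The positions \<open>J\<close> that are multiples of \<open>k\<close> contribute the factor \<open>\<rho> ^ n\<close> to the number of
  collisions, the other positions \<open>K\<close> the trivial factor 4 each. The factors 4 cancel against
  \<open>4 ^ (k * n)\<close>.
\<close>

lemma H_ent_ge_potential:
  fixes \<beta> :: real
  assumes pot: "collision_potential (\<beta> ^ k) \<rho> \<psi>" and "1 < \<beta>" "k \<ge> 1"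
  shows "real n * ln (4 / \<rho>) \<le> H_ent \<beta> (k * n)"
proof -
  define J where "J = (*) k ` {1..n}"
  define K where "K = {1..k * n} - J"
  have \<rho>: "0 < \<rho>" and \<psi>: "0 < \<psi> 0" "\<And>x. \<psi> x \<le> \<psi> 0" using pot by (auto simp: collision_potential_def)
  have card_J: "card J = n" unfolding J_def by (subst card_image) (use assms(3) in \<open>auto simp: inj_on_def\<close>)
  have J: "J \<subseteq> {1..k * n}" using assms(3) by (auto simp: J_def)
  have card_K: "card K + n = k * n"
    using card_J J card_mono[OF _ J] by (simp add: K_def card_Diff_subset finite_subset[OF J])
  have "collisions J (\<lambda>j. 1 / \<beta> ^ j) x \<le> \<rho> ^ n" for x
  proof -
    have "{n - n<..n} = {1..n}" by auto
    then have "collisions J (\<lambda>j. 1 / \<beta> ^ j) x * \<psi> 0 \<le> \<rho> ^ n * \<psi> x"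
      using collisions_le_potential[OF pot, of n n x] assms by (simp add: J_def)
    also have "\<dots> \<le> \<rho> ^ n * \<psi> 0" using \<rho> \<psi>(2) by (intro mult_left_mono) auto
    finally show ?thesis using \<psi>(1) by simp
  qed
  then have "collisions (K \<union> J) (\<lambda>j. 1 / \<beta> ^ j) 0 \<le> 4 ^ card K * \<rho> ^ n"
    by (intro collisions_union_le) (auto simp: K_def J_def)
  moreover have "K \<union> J = {1..k * n}" using J by (auto simp: K_def)
  ultimately have "real (k * n) * ln 4 - ln (4 ^ card K * \<rho> ^ n) \<le> H_ent \<beta> (k * n)"
    using assms(2) by (intro H_ent_ge_collisions) auto
  moreover have "real (k * n) * ln 4 = real (card K) * ln 4 + real n * ln 4"
    unfolding card_K[symmetric] by (simp add: distrib_right)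
  ultimately show ?thesis using \<rho> by (simp add: ln_mult ln_realpow ln_div right_diff_distrib)
qed

lemma garsia_entropy_ge_potential:
  fixes \<beta> :: real
  assumes pot: "collision_potential (\<beta> ^ k) \<rho> \<psi>" and "1 < \<beta>" "k \<ge> 1"
  shows "ln (4 / \<rho>) / ln (\<beta> ^ k) \<le> garsia_entropy \<beta>"
proof -
  have "convergent (\<lambda>n. H_ent \<beta> n / real n)"
    using assms by (intro subadditive_convergent H_ent_subadditive H_ent_nonneg)
  then obtain L where "(\<lambda>n. H_ent \<beta> n / real n) \<longlonglongrightarrow> L" by (auto simp: convergent_def)
  then have "(\<lambda>n. H_ent \<beta> n / real n / ln \<beta>) \<longlonglongrightarrow> L / ln \<beta>"
    using assms by (intro tendsto_divide tendsto_const) auto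
  then have lim: "(\<lambda>n. H_ent \<beta> n / (real n * ln \<beta>)) \<longlonglongrightarrow> L / ln \<beta>" by simp
  then have eq: "garsia_entropy \<beta> = L / ln \<beta>" unfolding garsia_entropy_def by (rule limI)
  have "strict_mono (\<lambda>n. k * n)" using assms by (auto simp: strict_mono_def)
  from LIMSEQ_subseq_LIMSEQ[OF lim this]
  have "(\<lambda>n. H_ent \<beta> (k * n) / (real (k * n) * ln \<beta>)) \<longlonglongrightarrow> L / ln \<beta>" by (simp add: o_def)
  moreover have "ln (4 / \<rho>) / ln (\<beta> ^ k) \<le> H_ent \<beta> (k * n) / (real (k * n) * ln \<beta>)" if "n \<ge> 1" for n
  proof -
    have "ln (4 / \<rho>) / ln (\<beta> ^ k) = real n * ln (4 / \<rho>) / (real (k * n) * ln \<beta>)"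
      using that assms by (simp add: ln_realpow)
    also have "\<dots> \<le> H_ent \<beta> (k * n) / (real (k * n) * ln \<beta>)"
      using assms by (intro divide_right_mono H_ent_ge_potential) auto
    finally show ?thesis .
  qed
  ultimately show ?thesis unfolding eq by (intro LIMSEQ_le_const) auto
qed

text \<open>
  The hypothesis on \<open>\<rho>\<close> is \<open>\<rho> < 4 / \<gamma> powr 0.82\<close> for \<open>\<gamma> = \<beta> ^ k\<close>, raised to the power 50 to make
  it a polynomial inequality; note \<open>0.82 = 41 / 50\<close>.
\<close>

lemma garsia_entropy_gt_potential:
  fixes \<beta> :: real
  assumes pot: "collision_potential (\<beta> ^ k) \<rho> \<psi>" and "1 < \<beta>" "k \<ge> 1"
    and small: "\<rho> ^ 50 * (\<beta> ^ k) ^ 41 < 4 ^ 50"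
  shows "0.82 < garsia_entropy \<beta>"
proof -
  define \<gamma> where "\<gamma> = \<beta> ^ k"
  have \<rho>: "0 < \<rho>" using pot by (simp add: collision_potential_def)
  have \<gamma>: "1 < \<gamma>" unfolding \<gamma>_def using assms by (intro one_less_power) auto
  have "ln (\<rho> ^ 50 * \<gamma> ^ 41) < ln (4 ^ 50)"
    by (subst ln_less_cancel_iff) (use small \<rho> \<gamma> in \<open>auto simp: \<gamma>_def\<close>)
  moreover have "ln (\<rho> ^ 50 * \<gamma> ^ 41) = 50 * ln \<rho> + 41 * ln \<gamma>"
    using \<rho> \<gamma> by (simp add: ln_mult ln_realpow)
  moreover have "ln ((4 :: real) ^ 50) = 50 * ln 4" by (subst ln_realpow) auto
  ultimately have "0.82 * ln \<gamma> < ln (4 / \<rho>)" using \<rho> by (simp add: ln_div)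
  then have "0.82 < ln (4 / \<rho>) / ln \<gamma>" using \<gamma> by (simp add: pos_less_divide_eq)
  also have "\<dots> \<le> garsia_entropy \<beta>"
    unfolding \<gamma>_def using assms(1-3) by (rule garsia_entropy_ge_potential)
  finally show ?thesis .
qed

text \<open>
  The weights 1, 2, 1 are those of the subdivision of a hat function into three hats of half the
  width. So for \<open>\<gamma> = 2\<close> the inequality holds with equality, and a larger \<open>\<gamma>\<close> only shrinks the
  left side.
\<close>

lemma hat_potential:
  assumes "2 \<le> \<gamma>"
  shows "collision_potential \<gamma> 2 (\<lambda>x. max 0 (1 - \<bar>x\<bar>))"
proof -
  have "max 0 (1 - \<bar>u + 1\<bar>) + 2 * max 0 (1 - \<bar>u\<bar>) + max 0 (1 - \<bar>u - 1\<bar>) = max 0 (2 - \<bar>u\<bar>)" for u :: real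
    by (simp add: max_def abs_if)
  moreover have "max 0 (2 - \<bar>\<gamma> * x\<bar>) \<le> 2 * max 0 (1 - \<bar>x\<bar>)" for x
    using mult_right_mono[OF assms, of "\<bar>x\<bar>"] assms by (auto simp: abs_mult max_def)
  ultimately show ?thesis unfolding collision_potential_def by auto
qed

section \<open>Step functions\<close>

text \<open>
  The walk for \<open>\<gamma>\<close> can return to 0 only from the interval \<open>(\<gamma> - 1) * \<bar>x\<bar> < 1\<close>, so a potential
  may vanish outside. The natural coordinate is \<open>t = 1 - (\<gamma> - 1) * \<bar>x\<bar>\<close>, which is 1 at the
  origin and 0 at the ends. The step function \<open>step_value w\<close> in this coordinate has the value
  \<open>w ! i\<close> for \<open>(i - 1) / 50 < t \<le> i / 50\<close>; for \<open>t \<le> 0\<close> its value is \<open>w ! 0\<close>, which will be 0.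
\<close>

definition step_value :: "int list \<Rightarrow> real \<Rightarrow> real" where
  "step_value w t = of_int (w ! nat \<lceil>50 * t\<rceil>)"

text \<open>
  The numbers \<open>A\<close>, \<open>B\<close>, \<open>L\<close> stand for \<open>A / 100 \<le> \<gamma> \<le> B / 100\<close> and \<open>\<rho> = L / 100\<close>. For \<open>x \<ge> 0\<close>
  with coordinate \<open>t\<close> the three successors \<open>\<gamma> x - 1\<close>, \<open>\<gamma> x\<close>, \<open>\<gamma> x + 1\<close> have the coordinates
  \<open>min (\<gamma> t) (2 - \<gamma> t)\<close>, \<open>1 - \<gamma> (1 - t)\<close> and \<open>2 - \<gamma> (2 - t)\<close>. The arguments of \<open>v\<close> bound these
  from above, times 5000, as \<open>\<gamma>\<close> ranges over its interval and \<open>t\<close> over the cell of index \<open>i\<close>;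
  upper bounds suffice since \<open>w\<close> is sorted, and 5000 is one of them as no coordinate exceeds 1.
  The step function has the value \<open>v z\<close> at \<open>z / 5000\<close>, the ceiling being computed by an integer
  division. The inequality between powers is \<open>\<rho> < 4 / \<gamma> powr 0.82\<close> at the right end of the
  interval.
\<close>

definition certificate :: "int \<Rightarrow> int \<Rightarrow> int \<Rightarrow> int list \<Rightarrow> bool" where
  "certificate A B L w \<longleftrightarrow> length w = 51 \<and> sorted w \<and> w ! 0 = 0 \<and> 0 < w ! 50 \<and>
     100 < A \<and> 0 < L \<and> L ^ 50 * B ^ 41 < 4 ^ 50 * 100 ^ 91 \<and>
     list_all (\<lambda>i. let v = (\<lambda>z. w ! nat (- (- z div 100))) in
       100 * (v (min 5000 (min (B * i) (10000 - A * (i - 1))))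
         + 2 * v (5000 - A * (50 - i)) + v (10000 - A * (100 - i))) \<le> L * w ! nat i) [1..50]"

lemma step_value_mono:
  assumes "length w = 51" "sorted w" "s \<le> t" "t \<le> 1"
  shows "step_value w s \<le> step_value w t"
proof -
  have "nat \<lceil>50 * s\<rceil> \<le> nat \<lceil>50 * t\<rceil>" using assms by (intro nat_mono ceiling_mono) auto
  moreover have "\<lceil>50 * t\<rceil> \<le> 50" using assms by (simp add: ceiling_le_iff)
  then have "nat \<lceil>50 * t\<rceil> < length w" using assms by linarith
  ultimately show ?thesis unfolding step_value_def using assms by (simp add: sorted_nth_mono)
qed

lemma certificate_potential:
  fixes \<gamma> :: real
  assumes cert: "certificate A B L w" and "A \<le> 100 * \<gamma>" "100 * \<gamma> \<le> B"
  shows "collision_potential \<gamma> (L / 100) (\<lambda>x. step_value w (1 - (\<gamma> - 1) * \<bar>x\<bar>))"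
proof -
  define \<psi> where "\<psi> = (\<lambda>x. step_value w (1 - (\<gamma> - 1) * \<bar>x\<bar>))"
  have w: "length w = 51" "sorted w" "w ! 0 = 0" "0 < w ! 50" and AL: "100 < A" "0 < L"
    using cert by (auto simp: certificate_def)
  have \<gamma>: "1 < \<gamma>" using AL assms(2) by linarith
  note mono = step_value_mono[OF w(1,2)]
  have zero: "step_value w t = 0" if "t \<le> 0" for t
    using that w(3) by (simp add: step_value_def)
  have nonneg: "0 \<le> step_value w t" if "t \<le> 1" for t
    using mono[of "min t 0" t] that zero[of "min t 0"] by simp
  have ineq: "\<psi> (\<gamma> * x + 1) + 2 * \<psi> (\<gamma> * x) + \<psi> (\<gamma> * x - 1) \<le> L / 100 * \<psi> x" if x: "0 \<le> x" for x
  proof -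
    define t where "t = 1 - (\<gamma> - 1) * x"
    have t1: "t \<le> 1" using \<gamma> x by (simp add: t_def)
    have \<psi>x: "\<psi> x = step_value w t" using x by (simp add: \<psi>_def t_def)
    have "\<psi> (\<gamma> * x) = step_value w (1 - \<gamma> * (1 - t))"
      using x \<gamma> by (simp add: \<psi>_def t_def algebra_simps)
    moreover have "\<psi> (\<gamma> * x + 1) = step_value w (2 - \<gamma> * (2 - t))"
      using x \<gamma> by (simp add: \<psi>_def t_def algebra_simps)
    moreover have "\<psi> (\<gamma> * x - 1) = step_value w (min (\<gamma> * t) (2 - \<gamma> * t))"
    proof -
      have "(\<gamma> - 1) * (\<gamma> * x - 1) = 1 - \<gamma> * t" by (simp add: t_def algebra_simps)
      then have "(\<gamma> - 1) * \<bar>\<gamma> * x - 1\<bar> = \<bar>1 - \<gamma> * t\<bar>" using \<gamma> by (metis abs_mult abs_of_pos diff_gt_0_iff_gt)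
      moreover have "1 - \<bar>1 - \<gamma> * t\<bar> = min (\<gamma> * t) (2 - \<gamma> * t)" by (simp add: abs_if min_def)
      ultimately show ?thesis by (simp add: \<psi>_def)
    qed
    moreover have "step_value w (2 - \<gamma> * (2 - t)) + 2 * step_value w (1 - \<gamma> * (1 - t))
        + step_value w (min (\<gamma> * t) (2 - \<gamma> * t)) \<le> L / 100 * step_value w t"
    proof (cases "t \<le> 0")
      case True
      then have "\<gamma> * t \<le> 0" using \<gamma> by (simp add: mult_nonneg_nonpos)
      then have "step_value w (2 - \<gamma> * (2 - t)) = 0" "step_value w (1 - \<gamma> * (1 - t)) = 0"
        "step_value w (min (\<gamma> * t) (2 - \<gamma> * t)) = 0"
        using \<gamma> by (auto intro!: zero simp: algebra_simps)
      then show ?thesis using zero[OF True] by simp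
    next
      case False
      define i where "i = \<lceil>50 * t\<rceil>"
      have i: "1 \<le> i" "i \<le> 50" "50 * t \<le> i" "i - 1 < 50 * t"
        using False t1 unfolding i_def by linarith+
      define z where "z = min 5000 (min (B * i) (10000 - A * (i - 1)))"
      define v where "v = (\<lambda>z. w ! nat (- (- z div 100)))"
      have v: "step_value w (z / 5000) = v z" for z
        using ceiling_divide_eq_div[of z 100, where ?'a = real] by (simp add: step_value_def v_def)
      have "100 * \<gamma> * (50 * t) \<le> B * i"
        using False i assms(3) AL \<gamma> unfolding of_int_mult by (intro mult_mono) auto
      moreover have "A * (i - 1) \<le> 100 * \<gamma> * (50 * t)"
        using False i assms(2) AL \<gamma> unfolding of_int_mult by (intro mult_mono) auto
      ultimately have "min (\<gamma> * t) (2 - \<gamma> * t) \<le> z / 5000"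
        unfolding z_def by (auto simp: min_def)
      then have 1: "step_value w (min (\<gamma> * t) (2 - \<gamma> * t)) \<le> v z"
        unfolding v[symmetric] by (rule mono) (simp add: z_def)
      have "A * (50 - i) \<le> 100 * \<gamma> * (50 - 50 * t)"
        using i assms(2) AL \<gamma> unfolding of_int_mult by (intro mult_mono) auto
      then have "1 - \<gamma> * (1 - t) \<le> (5000 - A * (50 - i)) / 5000" by (simp add: algebra_simps)
      then have 2: "step_value w (1 - \<gamma> * (1 - t)) \<le> v (5000 - A * (50 - i))"
        unfolding v[symmetric] by (rule mono) (use i AL in simp)
      have "A * (100 - i) \<le> 100 * \<gamma> * (100 - 50 * t)"
        using i assms(2) AL \<gamma> unfolding of_int_mult by (intro mult_mono) auto
      then have z3: "2 - \<gamma> * (2 - t) \<le> (10000 - A * (100 - i)) / 5000" by (simp add: algebra_simps)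
      have "100 * 50 \<le> A * (100 - i)" using i AL by (intro mult_mono) auto
      then have "5000 \<le> real_of_int (A * (100 - i))" by linarith
      then have 3: "step_value w (2 - \<gamma> * (2 - t)) \<le> v (10000 - A * (100 - i))"
        unfolding v[symmetric] by (intro mono z3) simp
      have "100 * (v z + 2 * v (5000 - A * (50 - i)) + v (10000 - A * (100 - i))) \<le> L * w ! nat i"
        using cert i(1,2) unfolding certificate_def list_all_iff Let_def v_def z_def by auto
      then have "real_of_int (100 * (v z + 2 * v (5000 - A * (50 - i)) + v (10000 - A * (100 - i))))
          \<le> real_of_int (L * w ! nat i)" by (simp only: of_int_le_iff)
      moreover have "step_value w t = w ! nat i" by (simp add: step_value_def i_def)
      ultimately show ?thesis using 1 2 3 by simp
    qed
    ultimately show ?thesis by (simp add: \<psi>x)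
  qed
  have even: "\<psi> (- x) = \<psi> x" for x by (simp add: \<psi>_def)
  \<comment> \<open>Reflection in the origin exchanges the two outer successors.\<close>
  have "\<psi> (\<gamma> * x + 1) + 2 * \<psi> (\<gamma> * x) + \<psi> (\<gamma> * x - 1) \<le> L / 100 * \<psi> x" for x
  proof (cases "0 \<le> x")
    case True
    then show ?thesis by (rule ineq)
  next
    case False
    have "\<gamma> * (- x) + 1 = - (\<gamma> * x - 1)" "\<gamma> * (- x) = - (\<gamma> * x)" "\<gamma> * (- x) - 1 = - (\<gamma> * x + 1)"
      by simp_all
    then have "\<psi> (\<gamma> * (- x) + 1) = \<psi> (\<gamma> * x - 1)" "\<psi> (\<gamma> * (- x)) = \<psi> (\<gamma> * x)"
      "\<psi> (\<gamma> * (- x) - 1) = \<psi> (\<gamma> * x + 1)"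
      by (simp_all only: even)
    then show ?thesis using ineq[of "- x"] False even[of x] by simp
  qed
  moreover have "0 \<le> \<psi> x \<and> \<psi> x \<le> \<psi> 0" for x
    using \<gamma> by (auto simp: \<psi>_def intro!: nonneg mono)
  moreover have "0 < \<psi> 0" using w(4) by (simp add: \<psi>_def step_value_def)
  ultimately show ?thesis
    using AL unfolding collision_potential_def \<psi>_def by auto
qed

lemma certificate_rate:
  fixes \<gamma> :: real
  assumes cert: "certificate A B L w" and "0 \<le> \<gamma>" "100 * \<gamma> \<le> B"
  shows "(L / 100) ^ 50 * \<gamma> ^ 41 < 4 ^ 50"
proof -
  have L: "0 < L" and less: "L ^ 50 * B ^ 41 < 4 ^ 50 * 100 ^ 91"
    using cert by (auto simp: certificate_def)
  have "(L / 100) ^ 50 * \<gamma> ^ 41 \<le> (L / 100) ^ 50 * (B / 100) ^ 41"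
    using assms L by (intro mult_left_mono power_mono) auto
  also have "\<dots> = real_of_int (L ^ 50 * B ^ 41) / 100 ^ 91"
    by (simp add: power_divide)
  also have "\<dots> < real_of_int (4 ^ 50 * 100 ^ 91) / 100 ^ 91"
    using less by (intro divide_strict_right_mono) (simp_all only: of_int_less_iff zero_less_power zero_less_numeral)
  finally show ?thesis by simp
qed

section \<open>Potentials for all bases in the fundamental interval\<close>

text \<open>
  The lists approximate the dominant eigenfunctions of the walk, rounded upwards until the
  inequalities hold on every cell. For each \<open>B\<close>, the number \<open>L\<close> is the largest one for which the
  resulting rate is small enough.
\<close>

lemma certificate_152_157:
  "certificate 152 157 276
    [0, 2, 3, 3, 6, 8, 12, 15, 20, 27, 33, 41, 44, 55, 63, 74, 89, 99, 113, 120, 139, 150,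
    172, 192, 204, 222, 245, 273, 283, 304, 323, 352, 366, 388, 404, 433, 444, 475, 481, 508,
    523, 549, 549, 574, 582, 599, 599, 612, 612, 625, 625]"
  by code_simp

lemma certificate_157_162:
  "certificate 157 162 269
    [0, 1, 1, 2, 2, 3, 3, 4, 5, 6, 8, 8, 10, 12, 13, 15, 17, 19, 21, 23, 26, 29, 32, 34, 37,
    40, 44, 45, 50, 53, 54, 59, 61, 65, 67, 71, 76, 76, 80, 83, 85, 89, 90, 93, 95, 96, 98,
    99, 99, 99, 100]"
  by code_simp

lemma certificate_162_169:
  "certificate 162 169 260
    [0, 2, 4, 9, 10, 17, 22, 26, 33, 44, 45, 55, 67, 72, 85, 99, 113, 117, 129, 142, 155, 174,
    187, 199, 219, 231, 257, 268, 292, 303, 315, 335, 350, 369, 394, 404, 430, 430, 452, 464,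
    472, 503, 510, 510, 534, 534, 551, 561, 561, 561, 561]"
  by code_simp

lemma certificate_169_178:
  "certificate 169 178 249
    [0, 5, 11, 15, 25, 30, 37, 51, 61, 74, 79, 90, 105, 125, 132, 150, 169, 184, 196, 201,
    222, 245, 260, 276, 311, 327, 346, 372, 400, 420, 447, 457, 466, 488, 500, 533, 551, 585,
    600, 600, 616, 627, 658, 672, 672, 692, 695, 703, 714, 714, 745]"
  by code_simp

lemma certificate_178_188:
  "certificate 178 188 238
    [0, 4, 8, 11, 18, 22, 26, 36, 42, 42, 50, 53, 61, 70, 84, 90, 98, 98, 107, 119, 122, 126,
    139, 143, 156, 166, 191, 198, 200, 214, 231, 231, 231, 239, 253, 257, 282, 285, 288, 295,
    298, 303, 322, 323, 323, 334, 334, 342, 347, 369, 369]"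
  by code_simp

lemma certificate_188_200:
  "certificate 188 200 226
    [0, 2, 3, 4, 6, 8, 9, 12, 13, 14, 17, 18, 20, 24, 26, 28, 29, 31, 31, 36, 37, 37, 40, 40,
    44, 48, 52, 55, 57, 58, 62, 65, 65, 69, 69, 70, 70, 77, 80, 81, 82, 83, 83, 86, 89, 89,
    90, 92, 93, 100, 100]"
  by code_simp

lemma ex_small_rate_potential:
  fixes \<gamma> :: real
  assumes "1.52 \<le> \<gamma>" "\<gamma> \<le> 1.52\<^sup>2"
  shows "\<exists>\<rho> \<psi>. collision_potential \<gamma> \<rho> \<psi> \<and> \<rho> ^ 50 * \<gamma> ^ 41 < 4 ^ 50"
proof (cases "2 \<le> \<gamma>")
  case True
  have "(2 :: real) ^ 50 * \<gamma> ^ 41 \<le> 2 ^ 50 * (1.52\<^sup>2) ^ 41"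
    using assms by (intro mult_left_mono power_mono) auto
  also have "\<dots> < 4 ^ 50" by (simp add: field_simps)
  finally show ?thesis using hat_potential[OF True] by blast
next
  case False
  have covered: ?thesis if "certificate A B L w" "A \<le> 100 * \<gamma>" "100 * \<gamma> \<le> B" for A B L w
    using certificate_potential[OF that] certificate_rate[OF that(1) _ that(3)] assms by fastforce
  consider "152 \<le> 100 * \<gamma>" "100 * \<gamma> \<le> 157"
    | "157 \<le> 100 * \<gamma>" "100 * \<gamma> \<le> 162"
    | "162 \<le> 100 * \<gamma>" "100 * \<gamma> \<le> 169"
    | "169 \<le> 100 * \<gamma>" "100 * \<gamma> \<le> 178"
    | "178 \<le> 100 * \<gamma>" "100 * \<gamma> \<le> 188"
    | "188 \<le> 100 * \<gamma>" "100 * \<gamma> \<le> 200"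
    using assms False by fastforce
  then show ?thesis
  proof cases
    case 1
    then show ?thesis by (intro covered[OF certificate_152_157]) simp_all
  next
    case 2
    then show ?thesis by (intro covered[OF certificate_157_162]) simp_all
  next
    case 3
    then show ?thesis by (intro covered[OF certificate_162_169]) simp_all
  next
    case 4
    then show ?thesis by (intro covered[OF certificate_169_178]) simp_all
  next
    case 5
    then show ?thesis by (intro covered[OF certificate_178_188]) simp_all
  next
    case 6
    then show ?thesis by (intro covered[OF certificate_188_200]) simp_all
  qed
qed

text \<open>
  The least power that reaches \<open>s\<close> overshoots by a factor of at most \<open>\<beta>\<close>, which is less than \<open>s\<close>
  unless that power is \<open>\<beta>\<close> itself.
\<close>

lemma ex_power_between:
  fixes \<beta> s :: real
  assumes "1 < \<beta>" "\<beta> \<le> s\<^sup>2" "1 < s"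
  obtains k where "k \<ge> 1" "s \<le> \<beta> ^ k" "\<beta> ^ k \<le> s\<^sup>2"
proof -
  define k where "k = (LEAST k. s \<le> \<beta> ^ k)"
  obtain m where "s \<le> \<beta> ^ m" using real_arch_pow[OF assms(1), of s] by (auto intro: less_imp_le)
  then have k: "s \<le> \<beta> ^ k" unfolding k_def by (rule LeastI)
  then have k1: "k \<ge> 1" using assms(3) by (cases k) auto
  have less: "\<beta> ^ (k - 1) < s"
    using not_less_Least[of "k - 1" "\<lambda>k. s \<le> \<beta> ^ k"] k1 unfolding k_def by force
  have "\<beta> ^ k \<le> s\<^sup>2"
  proof (cases "k = 1")
    case False
    then have "\<beta> ^ 1 \<le> \<beta> ^ (k - 1)" using k1 assms(1) by (intro power_increasing) auto
    then have "\<beta> * \<beta> ^ (k - 1) \<le> s * s"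
      using less assms by (intro mult_mono) auto
    then show ?thesis using k1 by (simp add: power2_eq_square flip: power_Suc)
  qed (use assms in simp)
  then show ?thesis using that k k1 by blast
qed

section \<open>The lower bound for Garsia's entropy\<close>

theorem theorem1p1:
  fixes \<beta> :: real
  assumes "1 < \<beta>" and "\<beta> < 2"
  shows "garsia_entropy \<beta> > 0.82"
proof -
  have "\<beta> \<le> 1.52\<^sup>2" using assms(2) by (simp add: power2_eq_square)
  then obtain k where k: "k \<ge> 1" "1.52 \<le> \<beta> ^ k" "\<beta> ^ k \<le> 1.52\<^sup>2"
    using ex_power_between[OF assms(1), of "1.52"] by auto
  obtain \<rho> \<psi> where "collision_potential (\<beta> ^ k) \<rho> \<psi>" "\<rho> ^ 50 * (\<beta> ^ k) ^ 41 < 4 ^ 50"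
    using ex_small_rate_potential[OF k(2,3)] by blast
  then show ?thesis using garsia_entropy_gt_potential assms(1) k(1) by blast
qed

end
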